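(* For every bivariate copula $C$ we have $$\frac{2}{9}\sqrt{3}\,\bigl(1+2\phi(C)\bigr)^{3/2}-1 \le \rho(C).$$ Moreover, for every value $p\in[-\tfrac12,1]$ there is a shuffle of $M$, call it $C$, with $\phi(C)=p$ for which equality holds, i.e. $\rho(C)=\frac{2}{9}\sqrt{3}\,(1+2p)^{3/2}-1$.
   Context: Let $\mathbb I=[0,1]$. A bivariate copula is a function $C:\mathbb I^2\to\mathbb I$ with $C(0,v)=C(u,0)=0$, $C(u,1)=u$, $C(1,v)=v$ for all $u,v\in\mathbb I$, and $C(u_2,v_2)-C(u_2,v_1)-C(u_1,v_2)+C(u_1,v_1)\ge 0$ whenever $0\le u_1\le u_2\le 1$, $0\le v_1\le v_2\le 1$. Spearman's rho is $\rho(C)=12\int_{\mathbb I^2}C(u,v)\,du\,dv-3$ and Spearman's footrule is $\phi(C)=6\int_0^1C(u,u)\,du-2$. The range of $\phi$ over all copulas is $[-\tfrac12,1]$. A shuffle of $M$, $C=M(n,J,\pi,\omega)$, is the copula determined by a positive integer $n$, splitting points $0=u_0\le u_1\le\dots\le u_{n-1}\le u_n=1$ (with $J=\{J_1,\dots,J_n\}$, $J_i=[u_{i-1},u_i]$; degenerate intervals allowed), a permutation $\pi\in S_n$ and a map $\omega:\{1,\dots,n\}\to\{-1,1\}$, as follows: let $0=v_0\le v_1\le\dots\le v_n=1$ be the points with $v_{\pi(i)}-v_{\pi(i)-1}=u_i-u_{i-1}$ for all $i$; the mass of $C$ is concentrated on the squares $J_i\times[v_{\pi(i)-1},v_{\pi(i)}]$,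 and in the $i$-th square mass $u_i-u_{i-1}$ is spread uniformly along the increasing diagonal of the square if $\omega(i)=1$ and along the decreasing diagonal if $\omega(i)=-1$. *)

theory Defs
  imports "HOL-Analysis.Analysis" "HOL-Combinatorics.Permutations"
begin

text \<open>Copulas are represented by total functions on the reals; only their values on the unit
  square are constrained and used.\<close>

definition copula :: "(real \<Rightarrow> real \<Rightarrow> real) \<Rightarrow> bool" where
  "copula C \<longleftrightarrow>
     (\<forall>u\<in>{0..1}. \<forall>v\<in>{0..1}. C u v \<in> {0..1}) \<and>
     (\<forall>u\<in>{0..1}. C u 0 = 0 \<and> C u 1 = u) \<and>
     (\<forall>v\<in>{0..1}. C 0 v = 0 \<and> C 1 v = v) \<and>
     (\<forall>u1 u2 v1 v2. 0 \<le> u1 \<and> u1 \<le> u2 \<and> u2 \<le> 1 \<and> 0 \<le> v1 \<and> v1 \<le> v2 \<and> v2 \<le> 1 \<longrightarrow>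
        C u2 v2 - C u2 v1 - C u1 v2 + C u1 v1 \<ge> 0)"

definition spearman_rho :: "(real \<Rightarrow> real \<Rightarrow> real) \<Rightarrow> real" where
  "spearman_rho C = 12 * integral ({0..1} \<times> {0..1}) (\<lambda>(u, v). C u v) - 3"

definition spearman_footrule :: "(real \<Rightarrow> real \<Rightarrow> real) \<Rightarrow> real" where
  "spearman_footrule C = 6 * integral {0..1} (\<lambda>u. C u u) - 2"

text \<open>The measure of total mass \<open>b - a\<close> spread uniformly along the increasing
  (\<open>s = 1\<close>) or decreasing (\<open>s = -1\<close>) diagonal of the square \<open>[a, b] \<times> [c, c + (b - a)]\<close>:
  a uniform distribution along a diagonal is the image of Lebesgue measure on the base \<open>[a, b]\<close>
  under the map lifting a point of the base to the diagonal.\<close>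

definition diagonal_mass :: "real \<Rightarrow> real \<Rightarrow> real \<Rightarrow> int \<Rightarrow> (real \<times> real) measure" where
  "diagonal_mass a b c s =
     distr (restrict_space lborel {a..b}) borel
       (\<lambda>t. (t, if s = 1 then c + (t - a) else c + (b - t)))"

text \<open>\<open>C\<close> is the shuffle \<open>M(n, J, \<pi>, \<omega>)\<close>, with \<open>J\<close> given by the splitting points \<open>u\<close>.
  The indices of the intervals are \<open>1, \<dots>, n\<close>; the points \<open>v 0, \<dots>, v n\<close> are uniquely
  determined by \<open>n\<close>, \<open>u\<close> and \<open>\<pi>\<close>. That the mass of \<open>C\<close> is the sum of the
  diagonal masses means that \<open>C x y\<close> is the total mass of the rectangle \<open>[0, x] \<times> [0, y]\<close>.\<close>

definition is_shuffle ::
  "(real \<Rightarrow> real \<Rightarrow> real) \<Rightarrow> nat \<Rightarrow> (nat \<Rightarrow> real) \<Rightarrow> (nat \<Rightarrow> nat) \<Rightarrow> (nat \<Rightarrow> int) \<Rightarrow> bool" where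
  "is_shuffle C n u \<pi> \<omega> \<longleftrightarrow>
     0 < n \<and>
     u 0 = 0 \<and> u n = 1 \<and> (\<forall>i\<in>{1..n}. u (i - 1) \<le> u i) \<and>
     \<pi> permutes {1..n} \<and>
     (\<forall>i\<in>{1..n}. \<omega> i \<in> {-1, 1}) \<and>
     (\<exists>v :: nat \<Rightarrow> real.
        v 0 = 0 \<and> v n = 1 \<and> (\<forall>i\<in>{1..n}. v (i - 1) \<le> v i) \<and>
        (\<forall>i\<in>{1..n}. v (\<pi> i) - v (\<pi> i - 1) = u i - u (i - 1)) \<and>
        (\<forall>x\<in>{0..1}. \<forall>y\<in>{0..1}. C x y =
           (\<Sum>i=1..n. measure (diagonal_mass (u (i - 1)) (u i) (v (\<pi> i - 1)) (\<omega> i))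
                        ({0..x} \<times> {0..y}))))"

definition shuffle_of_M :: "(real \<Rightarrow> real \<Rightarrow> real) \<Rightarrow> bool" where
  "shuffle_of_M C \<longleftrightarrow> (\<exists>n u \<pi> \<omega>. is_shuffle C n u \<pi> \<omega>)"

end

theory Submission imports Defs begin

text \<open>
  Let \<open>(U, V)\<close> have distribution function \<open>C\<close>. Then \<open>\<rho> = 1 - 6 E (U - V)\<^sup>2\<close> and
  \<open>\<phi> = 1 - 3 E \<bar>U - V\<bar>\<close>, so the claim bounds the second moment of \<open>U - V\<close> from above by a
  concave function of its first absolute moment. Such a bound is the infimum of its tangents, and
  the tangent of slope \<open>l \<in> [0, 1]\<close> asks for the maximum of \<open>E h(U - V)\<close>, where
  \<open>h d = d\<^sup>2 - l \<bar>d\<bar>\<close>. This is an optimal transport problem, and it has a dual certificate: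
  with \<open>s x = \<bar>2 x - 1\<bar>\<close> and \<open>f x = max 0 (h (s x)) / 2\<close> one has
  \<open>h (x - y) \<le> f x + f y\<close> on the unit square. Since both margins are uniform,
  \<open>E h(U - V) \<le> 2 \<integral> f\<close>.

  In terms of the integral \<open>I\<close> of \<open>C\<close> over the square and the integral \<open>D\<close> of the diagonal
  section, the tangent bound reads \<open>I - l D \<ge> 1/6 - l/4 - l\<^sup>3/12\<close> (\<open>copula_tangent_bound\<close>). To
  prove it without the measure of \<open>C\<close>, the certificate, rewritten as a bound on
  \<open>x y - l min x y\<close> (\<open>potential_bound\<close>), is averaged over the masses that \<open>C\<close> gives to the cells
  of an \<open>N \<times> N\<close> grid; by monotonicity the resulting sums bound \<open>I\<close> and \<open>D\<close> on the correct side,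
  and \<open>N\<close> tends to infinity. The slope with \<open>l\<^sup>2 = (1 + 2 \<phi>) / 3 = 4 D - 1\<close> then turns the
  tangent bound into \<open>\<rho> \<ge> 2 l\<^sup>3 - 1\<close>, which is the claim.

  Equality in the certificate holds for \<open>y = x\<close> where \<open>s x \<le> l\<close> and for \<open>y = 1 - x\<close> elsewhere. This is a
  shuffle of three intervals: with \<open>a = (1 - l) / 2\<close>, the outer intervals \<open>[0, a]\<close> and
  \<open>[1 - a, 1]\<close> are exchanged by the reflection, and \<open>[a, 1 - a]\<close> is kept fixed. For this shuffle
  both integrals are evaluated in closed form.
\<close>

section \<open>Copulas\<close>

lemma copula_grounded:
  assumes "copula C" "t \<in> {0..1}"
  shows "C t 0 = 0" "C 0 t = 0" "C t 1 = t" "C 1 t = t"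
  using assms unfolding copula_def by auto

lemma copula_rect_nonneg:
  assumes "copula C" "0 \<le> u1" "u1 \<le> u2" "u2 \<le> 1" "0 \<le> v1" "v1 \<le> v2" "v2 \<le> 1"
  shows "C u2 v2 - C u2 v1 - C u1 v2 + C u1 v1 \<ge> 0"
  using assms unfolding copula_def by blast

lemma copula_mono:
  assumes "copula C" "0 \<le> u" "u \<le> u'" "u' \<le> 1" "0 \<le> v" "v \<le> v'" "v' \<le> 1"
  shows "C u v \<le> C u' v'"
proof -
  have "C u v \<le> C u' v"
    using copula_rect_nonneg[OF assms(1-4), of 0 v] copula_grounded[OF assms(1)] assms by auto
  also have "\<dots> \<le> C u' v'"
    using copula_rect_nonneg[OF assms(1), of 0 u' v v'] copula_grounded[OF assms(1)] assms by auto
  finally show ?thesis .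
qed

lemma copula_lipschitz:
  assumes C: "copula C" and uv: "u \<in> {0..1}" "v \<in> {0..1}" "u' \<in> {0..1}" "v' \<in> {0..1}"
  shows "\<bar>C u v - C u' v'\<bar> \<le> \<bar>u - u'\<bar> + \<bar>v - v'\<bar>"
proof -
  have 1: "\<bar>C x w - C y w\<bar> \<le> y - x" if "0 \<le> x" "x \<le> y" "y \<le> 1" "w \<in> {0..1}" for x y w
    using copula_rect_nonneg[OF C that(1-3), of w 1] copula_mono[OF C that(1-3), of w w]
      copula_grounded[OF C, of x] copula_grounded[OF C, of y] that by auto
  have 2: "\<bar>C w x - C w y\<bar> \<le> y - x" if "0 \<le> x" "x \<le> y" "y \<le> 1" "w \<in> {0..1}" for x y w
    using copula_rect_nonneg[OF C _ _ _ that(1-3), of w 1] copula_mono[OF C _ _ _ that(1-3), of w w]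
      copula_grounded[OF C, of x] copula_grounded[OF C, of y] that by auto
  have "\<bar>C u v - C u' v\<bar> \<le> \<bar>u - u'\<bar>"
    using 1[of u u' v] 1[of u' u v] uv by (cases "u \<le> u'") auto
  moreover have "\<bar>C u' v - C u' v'\<bar> \<le> \<bar>v - v'\<bar>"
    using 2[of v v' u'] 2[of v' v u'] uv by (cases "v \<le> v'") auto
  ultimately show ?thesis by linarith
qed

lemma copula_continuous:
  assumes "copula C"
  shows "continuous_on ({0..1} \<times> {0..1}) (\<lambda>(u, v). C u v)"
proof -
  have "\<bar>C u v - C u' v'\<bar> \<le> 2 * dist (u, v) (u', v')"
    if "u \<in> {0..1}" "v \<in> {0..1}" "u' \<in> {0..1}" "v' \<in> {0..1}" for u v u' v'
    using copula_lipschitz[OF assms that] dist_fst_le[of "(u, v)" "(u', v')"]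
      dist_snd_le[of "(u, v)" "(u', v')"] by (simp add: dist_real_def)
  then have "2-lipschitz_on ({0..1} \<times> {0..1}) (\<lambda>(u, v). C u v)"
    by (intro lipschitz_onI) (auto simp: dist_real_def)
  then show ?thesis by (rule lipschitz_on_continuous_on)
qed

lemma copula_continuous_compose:
  assumes "copula C" "continuous_on S f" "continuous_on S g" "f ` S \<subseteq> {0..1}" "g ` S \<subseteq> {0..1}"
  shows "continuous_on S (\<lambda>x. C (f x) (g x))"
proof -
  have "continuous_on S (\<lambda>x. (\<lambda>(u, v). C u v) (f x, g x))"
    by (rule continuous_on_compose2[OF copula_continuous[OF assms(1)]])
      (use assms in \<open>auto intro!: continuous_intros\<close>)
  then show ?thesis by simp
qed

lemma copula_double_integral:
  assumes "copula C"
  shows "integral ({0..1} \<times> {0..1}) (\<lambda>(u, v). C u v)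
           = integral {0..1} (\<lambda>u. integral {0..1} (\<lambda>v. C u v))"
    and "(\<lambda>u. integral {0..1} (\<lambda>v. C u v)) integrable_on {0..1}"
proof -
  have c: "continuous_on (cbox (0::real, 0::real) (1, 1)) (\<lambda>(u, v). C u v)"
    using copula_continuous[OF assms] by (simp add: cbox_Pair_eq)
  from integral_integrable_2dim[OF c]
  show "(\<lambda>u. integral {0..1} (\<lambda>v. C u v)) integrable_on {0..1}" by simp
  from integral_prod_continuous[OF c]
  show "integral ({0..1} \<times> {0..1}) (\<lambda>(u, v). C u v)
           = integral {0..1} (\<lambda>u. integral {0..1} (\<lambda>v. C u v))"
    by (simp add: cbox_Pair_eq)
qed

section \<open>Riemann sums\<close>

text \<open>For a monotone integrand the left and right sums are one-sided bounds at every finite stage,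
  so no modulus of continuity enters the limit.\<close>

lemma riemann_sums_mono:
  fixes f :: "real \<Rightarrow> real"
  assumes mono: "mono_on {0..1} f" and int: "f integrable_on {0..1}" and N: "N > 0"
  shows "(\<Sum>k<N. f (real k / real N)) / real N \<le> integral {0..1} f"
    and "integral {0..1} f \<le> (\<Sum>k<N. f (real (Suc k) / real N)) / real N"
proof -
  have cell: "f (real k / N) / N \<le> integral {real k / N..real (Suc k) / N} f \<and>
      integral {real k / N..real (Suc k) / N} f \<le> f (real (Suc k) / N) / N" if "k < N" for k
  proof -
    have le: "real k / N \<le> real (Suc k) / N" "real (Suc k) / N \<le> 1" "0 \<le> real k / N"
      using that by (auto simp: field_simps)
    have i: "f integrable_on {real k / N..real (Suc k) / N}"
      using int le by (intro integrable_subinterval_real[OF int]) auto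
    have d: "real (Suc k) / N - real k / N = 1 / N"
      by (simp add: add_divide_distrib)
    have "integral {real k / N..real (Suc k) / N} (\<lambda>_. f (real k / N))
        \<le> integral {real k / N..real (Suc k) / N} f"
      using le by (intro integral_le i) (auto intro!: mono_onD[OF mono] intro: order_trans[OF le(3)] simp del: of_nat_Suc)
    moreover have "integral {real k / N..real (Suc k) / N} f
        \<le> integral {real k / N..real (Suc k) / N} (\<lambda>_. f (real (Suc k) / N))"
      using le by (intro integral_le i) (auto intro!: mono_onD[OF mono] intro: order_trans[OF le(3)] simp del: of_nat_Suc)
    ultimately show ?thesis using le d by (simp del: of_nat_Suc)
  qed
  have split: "integral {0..real m / N} f = (\<Sum>k<m. integral {real k / N..real (Suc k) / N} f)"
    if "m \<le> N" for m
    using that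
  proof (induction m)
    case (Suc m)
    have "integral {0..real m / N} f + integral {real m / N..real (Suc m) / N} f
        = integral {0..real (Suc m) / N} f"
      using Suc.prems
      by (intro Henstock_Kurzweil_Integration.integral_combine integrable_subinterval_real[OF int])
        (auto simp: field_simps)
    then show ?case using Suc by (simp del: of_nat_Suc)
  qed simp
  have "integral {0..1} f = (\<Sum>k<N. integral {real k / N..real (Suc k) / N} f)"
    using split[of N] N by simp
  then show "(\<Sum>k<N. f (real k / real N)) / real N \<le> integral {0..1} f"
    and "integral {0..1} f \<le> (\<Sum>k<N. f (real (Suc k) / real N)) / real N"
    using cell by (auto simp: sum_divide_distrib simp del: of_nat_Suc intro!: sum_mono)
qed

section \<open>The dual potential\<close>

text \<open>The dual potential of the kernel \<open>x y - l min x y\<close>. That kernel equals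
  \<open>(x\<^sup>2 + y\<^sup>2) / 2 - l (x + y) / 2 - h (x - y) / 2\<close> with \<open>h d = d\<^sup>2 - l \<bar>d\<bar>\<close>; the first two
  terms already split into a function of \<open>x\<close> and one of \<open>y\<close>, and the maximum in the definition
  serves to dominate \<open>h\<close>.\<close>

definition potential :: "real \<Rightarrow> real \<Rightarrow> real" where
  "potential l x = (x\<^sup>2 - l * x - max 0 (\<bar>2 * x - 1\<bar>\<^sup>2 - l * \<bar>2 * x - 1\<bar>) / 2) / 2"

text \<open>The reason is that \<open>h d \<le> max 0 (h s) / 2 + max 0 (h t) / 2\<close> for \<open>d = \<bar>x - y\<bar>\<close>,
  \<open>s = \<bar>2 x - 1\<bar>\<close> and \<open>t = \<bar>2 y - 1\<bar>\<close>. If \<open>d \<le> l\<close> then \<open>h d \<le> 0\<close>. Otherwise \<open>h\<close> is increasing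
  from \<open>d\<close> on, \<open>d\<close> is at most the midpoint of \<open>s\<close> and \<open>t\<close> by the triangle inequality, and \<open>h\<close> is
  convex on the nonnegative numbers.\<close>

lemma potential_bound:
  assumes l: "0 \<le> l"
  shows "potential l x + potential l y \<le> x * y - l * min x y"
proof -
  define h where "h = (\<lambda>d::real. d\<^sup>2 - l * d)"
  have key: "h (y - x) \<le> max 0 (h \<bar>2 * x - 1\<bar>) / 2 + max 0 (h \<bar>2 * y - 1\<bar>) / 2"
    if "x \<le> y" for x y
  proof (cases "y - x \<le> l")
    case True
    have "h (y - x) = (y - x) * ((y - x) - l)" by (simp add: h_def power2_eq_square algebra_simps)
    also have "\<dots> \<le> 0" using True that by (simp add: mult_nonneg_nonpos)
    finally show ?thesis by linarith
  next
    case False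
    define s t where "s = \<bar>2 * x - 1\<bar>" and "t = \<bar>2 * y - 1\<bar>"
    have "1 - 2 * x \<le> s" "2 * y - 1 \<le> t" by (auto simp: s_def t_def)
    then have d: "y - x \<le> (s + t) / 2" by (simp add: field_simps)
    \<comment> \<open>the product is the difference of the values of \<open>h\<close> at the midpoint and at \<open>y - x\<close>\<close>
    have "0 \<le> ((s + t) / 2 - (y - x)) * ((s + t) / 2 + (y - x) - l)"
      by (intro mult_nonneg_nonneg) (use d False l in argo)+
    moreover have "(r - d) * (r + d - l) = h r - h d" for r d
      by (simp add: h_def power2_eq_square algebra_simps)
    ultimately have "h (y - x) \<le> h ((s + t) / 2)"
      by simp
    also have "h ((s + t) / 2) = (h s + h t) / 2 - ((s - t) / 2)\<^sup>2"
      by (simp add: h_def power2_eq_square field_simps)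
    also have "\<dots> \<le> max 0 (h s) / 2 + max 0 (h t) / 2"
      using zero_le_power2[of "(s - t) / 2"] max.cobounded2[of "h s" 0] max.cobounded2[of "h t" 0]
      by argo
    finally show ?thesis unfolding s_def t_def .
  qed
  have id: "x * y - l * x - (x\<^sup>2 - l * x) / 2 - (y\<^sup>2 - l * y) / 2 = - h (y - x) / 2" for x y
    by (simp add: h_def power2_eq_square field_simps)
  have p: "potential l z = (z\<^sup>2 - l * z) / 2 - max 0 (h \<bar>2 * z - 1\<bar>) / 4" for z
    by (simp add: potential_def h_def)
  show ?thesis
  proof (cases "x \<le> y")
    case True
    show ?thesis
      using key[OF True] id[of x y] True unfolding p by (simp add: min_def)
  next
    case False
    then have "y \<le> x" by simp
    have "min x y = y" using False by auto
    then show ?thesis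
      using key[OF \<open>y \<le> x\<close>] id[of y x] unfolding p by (simp add: mult.commute[of x y])
  qed
qed

text \<open>The potential itself is not monotone. Subtracting it from a steep enough linear function makes
  it accessible to the sums of monotone functions, and \<open>2\<close> is steep enough: \<open>(x\<^sup>2 - l x) / 2\<close> and a
  quarter of the maximum each have slopes in \<open>[-1, 1]\<close>.\<close>

lemma potential_one_sided_lipschitz:
  assumes l: "0 \<le> l" "l \<le> 1"
  shows "mono_on {0..1} (\<lambda>x. 2 * x - potential l x)"
proof (intro mono_onI)
  fix x y :: real assume xy: "x \<in> {0..1}" "y \<in> {0..1}" "x \<le> y"
  define s t where "s = \<bar>2 * x - 1\<bar>" and "t = \<bar>2 * y - 1\<bar>"
  have st: "s \<in> {0..1}" "t \<in> {0..1}" "\<bar>s - t\<bar> \<le> 2 * (y - x)"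
    using xy unfolding s_def t_def by auto
  have "\<bar>(s\<^sup>2 - l * s) - (t\<^sup>2 - l * t)\<bar> = \<bar>s - t\<bar> * \<bar>s + t - l\<bar>"
    unfolding abs_mult[symmetric] by (simp add: power2_eq_square algebra_simps)
  also have "\<dots> \<le> (2 * (y - x)) * 2"
    using st l xy by (intro mult_mono) auto
  finally have 1: "max 0 (s\<^sup>2 - l * s) - max 0 (t\<^sup>2 - l * t) \<le> 4 * (y - x)"
    by linarith
  have 2: "y\<^sup>2 - x\<^sup>2 \<le> 2 * (y - x)"
    using mult_right_mono[of "y + x" 2 "y - x"] xy by (simp add: power2_eq_square algebra_simps)
  have 3: "l * x \<le> l * y" using xy l by (simp add: mult_left_mono)
  show "2 * x - potential l x \<le> 2 * y - potential l y"
    using 1 2 3 unfolding potential_def s_def[symmetric] t_def[symmetric]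
    by argo
qed

text \<open>The maximum in the potential vanishes exactly on the middle interval \<open>[a, b]\<close> below, where
  \<open>\<bar>2 x - 1\<bar> \<le> l\<close>.\<close>

lemma potential_integral:
  assumes l: "0 \<le> l" "l \<le> 1"
  shows "(potential l has_integral (1 / 12 - l / 8 - l ^ 3 / 24)) {0..1}"
proof -
  define a b where "a = (1 - l) / 2" and "b = (1 + l) / 2"
  have ab: "0 \<le> a" "a \<le> b" "b \<le> 1" using l by (auto simp: a_def b_def)
  define F0 where "F0 = (\<lambda>x::real. x ^ 3 / 6 - l * x\<^sup>2 / 4)"
  define F1 where "F1 = (\<lambda>x::real. (1 - 2 * x) ^ 3 / 24 - l * (1 - 2 * x)\<^sup>2 / 16)"
  define F2 where "F2 = (\<lambda>x::real. (2 * x - 1) ^ 3 / 24 - l * (2 * x - 1)\<^sup>2 / 16)"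
  have "((\<lambda>x. (x\<^sup>2 - l * x - ((1 - 2 * x)\<^sup>2 - l * (1 - 2 * x)) / 2) / 2) has_integral
      (F0 a + F1 a) - (F0 0 + F1 0)) {0..a}"
    unfolding F0_def F1_def using ab
    by (intro fundamental_theorem_of_calculus)
      (auto intro!: derivative_eq_intros simp: has_real_derivative_iff_has_vector_derivative[symmetric]
        field_simps power2_eq_square)
  then have 1: "(potential l has_integral (F0 a + F1 a) - (F0 0 + F1 0)) {0..a}"
  proof (rule has_integral_eq[rotated])
    fix x assume x: "x \<in> {0..a}"
    then have s: "\<bar>2 * x - 1\<bar> = 1 - 2 * x" "l \<le> 1 - 2 * x" using l by (auto simp: a_def)
    have "0 \<le> (1 - 2 * x) * ((1 - 2 * x) - l)"
      using s l by (intro mult_nonneg_nonneg) auto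
    then have "max 0 ((1 - 2 * x)\<^sup>2 - l * (1 - 2 * x)) = (1 - 2 * x)\<^sup>2 - l * (1 - 2 * x)"
      by (simp add: power2_eq_square algebra_simps)
    then show "(x\<^sup>2 - l * x - ((1 - 2 * x)\<^sup>2 - l * (1 - 2 * x)) / 2) / 2 = potential l x"
      unfolding potential_def s by simp
  qed
  have "((\<lambda>x. (x\<^sup>2 - l * x) / 2) has_integral F0 b - F0 a) {a..b}"
    unfolding F0_def using ab
    by (intro fundamental_theorem_of_calculus)
      (auto intro!: derivative_eq_intros simp: has_real_derivative_iff_has_vector_derivative[symmetric]
        field_simps power2_eq_square)
  then have 2: "(potential l has_integral F0 b - F0 a) {a..b}"
  proof (rule has_integral_eq[rotated])
    fix x assume x: "x \<in> {a..b}"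
    then have s: "\<bar>2 * x - 1\<bar> \<le> l" using l by (auto simp: a_def b_def field_simps)
    then have "\<bar>2 * x - 1\<bar> * (\<bar>2 * x - 1\<bar> - l) \<le> 0"
      by (intro mult_nonneg_nonpos) auto
    then have "max 0 (\<bar>2 * x - 1\<bar>\<^sup>2 - l * \<bar>2 * x - 1\<bar>) = 0"
      by (simp add: power2_eq_square algebra_simps)
    then show "(x\<^sup>2 - l * x) / 2 = potential l x"
      unfolding potential_def by simp
  qed
  have "((\<lambda>x. (x\<^sup>2 - l * x - ((2 * x - 1)\<^sup>2 - l * (2 * x - 1)) / 2) / 2) has_integral
      (F0 1 - F2 1) - (F0 b - F2 b)) {b..1}"
    unfolding F0_def F2_def using ab
    by (intro fundamental_theorem_of_calculus)
      (auto intro!: derivative_eq_intros simp: has_real_derivative_iff_has_vector_derivative[symmetric]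
        field_simps power2_eq_square)
  then have 3: "(potential l has_integral (F0 1 - F2 1) - (F0 b - F2 b)) {b..1}"
  proof (rule has_integral_eq[rotated])
    fix x assume x: "x \<in> {b..1}"
    then have s: "\<bar>2 * x - 1\<bar> = 2 * x - 1" "l \<le> 2 * x - 1" using l by (auto simp: b_def)
    have "0 \<le> (2 * x - 1) * ((2 * x - 1) - l)"
      using s l by (intro mult_nonneg_nonneg) auto
    then have "max 0 ((2 * x - 1)\<^sup>2 - l * (2 * x - 1)) = (2 * x - 1)\<^sup>2 - l * (2 * x - 1)"
      by (simp add: power2_eq_square algebra_simps)
    then show "(x\<^sup>2 - l * x - ((2 * x - 1)\<^sup>2 - l * (2 * x - 1)) / 2) / 2 = potential l x"
      unfolding potential_def s by simp
  qed
  have "(potential l has_integral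
      (F0 a + F1 a) - (F0 0 + F1 0) + (F0 b - F0 a) + ((F0 1 - F2 1) - (F0 b - F2 b))) {0..1}"
    using has_integral_combine[OF _ _ has_integral_combine[OF _ _ 1 2] 3] ab by simp
  moreover have "(F0 a + F1 a) - (F0 0 + F1 0) + (F0 b - F0 a) + ((F0 1 - F2 1) - (F0 b - F2 b))
      = 1 / 12 - l / 8 - l ^ 3 / 24"
    unfolding F0_def F1_def F2_def a_def b_def
    by (simp add: power2_eq_square power3_eq_cube field_simps)
  ultimately show ?thesis by simp
qed

section \<open>The grid\<close>

definition cell_mass :: "(real \<Rightarrow> real \<Rightarrow> real) \<Rightarrow> nat \<Rightarrow> nat \<Rightarrow> nat \<Rightarrow> real" where
  "cell_mass C N k l =
     C (real (Suc k) / N) (real (Suc l) / N) - C (real (Suc k) / N) (real l / N)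
     - C (real k / N) (real (Suc l) / N) + C (real k / N) (real l / N)"

lemma cell_mass_nonneg:
  assumes "copula C" "k < N" "l < N"
  shows "cell_mass C N k l \<ge> 0"
  unfolding cell_mass_def using assms
  by (intro copula_rect_nonneg) (auto simp: field_simps)

lemma cell_mass_cumulative:
  assumes "copula C" "i \<le> N" "j \<le> N"
  shows "C (real i / N) (real j / N) = (\<Sum>k<i. \<Sum>l<j. cell_mass C N k l)"
proof -
  have in01: "real k / N \<in> {0..1}" if "k \<le> N" for k
    using that by (auto simp: divide_le_eq_1)
  define D where "D = (\<lambda>k l. C (real (Suc k) / N) (real l / N) - C (real k / N) (real l / N))"
  have "(\<Sum>l<j. cell_mass C N k l) = D k j" if "k < i" for k
  proof -
    have "(\<Sum>l<j. cell_mass C N k l) = (\<Sum>l<j. D k (Suc l) - D k l)"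
      by (intro sum.cong) (auto simp: cell_mass_def D_def)
    also have "\<dots> = D k j - D k 0" by (rule sum_lessThan_telescope)
    also have "D k 0 = 0"
      using that assms in01[of k] in01[of "Suc k"]
      by (simp add: D_def copula_grounded del: of_nat_Suc)
    finally show ?thesis by simp
  qed
  then have "(\<Sum>k<i. \<Sum>l<j. cell_mass C N k l) = (\<Sum>k<i. D k j)" by simp
  also have "\<dots> = C (real i / N) (real j / N) - C 0 (real j / N)"
    unfolding D_def
    using sum_lessThan_telescope[of "\<lambda>k. C (real k / N) (real j / N)" i] by simp
  also have "C 0 (real j / N) = 0"
    using assms in01[of j] by (simp add: copula_grounded)
  finally show ?thesis by simp
qed

lemma cell_mass_row_sum:
  assumes "copula C" "N > 0" "k < N"
  shows "(\<Sum>l<N. cell_mass C N k l) = 1 / N"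
proof -
  have in01: "real k / N \<in> {0..1}" "real (Suc k) / N \<in> {0..1}"
    using assms by (auto simp: field_simps)
  have "C (real (Suc k) / N) (real N / N) = C (real k / N) (real N / N) + (\<Sum>l<N. cell_mass C N k l)"
    using cell_mass_cumulative[OF assms(1), of "Suc k" N N]
      cell_mass_cumulative[OF assms(1), of k N N] assms by (simp del: of_nat_Suc)
  then show ?thesis
    using copula_grounded[OF assms(1) in01(1)] copula_grounded[OF assms(1) in01(2)] assms(2)
    by (simp add: field_simps)
qed

lemma cell_mass_col_sum:
  assumes "copula C" "N > 0" "l < N"
  shows "(\<Sum>k<N. cell_mass C N k l) = 1 / N"
proof -
  have in01: "real l / N \<in> {0..1}" "real (Suc l) / N \<in> {0..1}"
    using assms by (auto simp: field_simps)
  have "C (real N / N) (real (Suc l) / N) = C (real N / N) (real l / N) + (\<Sum>k<N. cell_mass C N k l)"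
    using cell_mass_cumulative[OF assms(1), of N N "Suc l"]
      cell_mass_cumulative[OF assms(1), of N N l] assms by (simp add: sum.distrib del: of_nat_Suc)
  then show ?thesis
    using copula_grounded[OF assms(1) in01(1)] copula_grounded[OF assms(1) in01(2)] assms(2)
    by (simp add: field_simps)
qed

text \<open>Indicators free the ranges of summation from the corner \<open>(i, j)\<close>, so that a sum over all
  corners can be interchanged with the sum over the cells.\<close>

lemma cell_mass_cumulative_indicator:
  assumes "copula C" "i \<le> N" "j \<le> N"
  shows "C (real i / N) (real j / N)
    = (\<Sum>k<N. \<Sum>l<N. cell_mass C N k l * (of_bool (k < i) * of_bool (l < j)))"
proof -
  have ind: "(\<Sum>k<m. g k) = (\<Sum>k<N. g k * of_bool (k < m))" if "m \<le> N" for g :: "nat \<Rightarrow> real" and m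
  proof -
    have "(\<Sum>k<N. g k * of_bool (k < m)) = (\<Sum>k<m. g k)"
      using that by (intro sum.mono_neutral_cong_right) auto
    then show ?thesis by simp
  qed
  show ?thesis
    unfolding cell_mass_cumulative[OF assms] ind[OF assms(2)] ind[OF assms(3)]
    by (simp only: sum_distrib_right mult.assoc mult.commute[of "of_bool (_ < j)"])
qed

lemma sum_swap_pairs:
  "(\<Sum>i\<in>A. \<Sum>j\<in>B. \<Sum>k\<in>C. \<Sum>l\<in>D. f i j k l) =
   (\<Sum>k\<in>C. \<Sum>l\<in>D. \<Sum>i\<in>A. \<Sum>j\<in>B. f i j k l)"
proof -
  have "(\<Sum>i\<in>A. \<Sum>j\<in>B. \<Sum>k\<in>C. \<Sum>l\<in>D. f i j k l) =
      (\<Sum>i\<in>A. \<Sum>k\<in>C. \<Sum>l\<in>D. \<Sum>j\<in>B. f i j k l)"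
    by (intro sum.cong refl) (subst sum.swap, intro sum.cong refl sum.swap)
  also have "\<dots> = (\<Sum>k\<in>C. \<Sum>l\<in>D. \<Sum>i\<in>A. \<Sum>j\<in>B. f i j k l)"
    by (subst sum.swap, intro sum.cong refl sum.swap)
  finally show ?thesis .
qed

text \<open>In \<open>grid_sum\<close> and \<open>grid_diagonal_sum\<close> each cell is counted once for every grid point that
  dominates it. These counts are the discrete forms of the kernels \<open>x y\<close> and \<open>min x y\<close> in the
  distances \<open>x\<close> and \<open>y\<close> of the cell from the sides \<open>u = 1\<close> and \<open>v = 1\<close>.\<close>

lemma grid_sum:
  assumes "copula C"
  shows "(\<Sum>i<N. \<Sum>j<N. C (real i / N) (real j / N))
    = (\<Sum>k<N. \<Sum>l<N. cell_mass C N k l * (real (N - Suc k) * real (N - Suc l)))"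
proof -
  have count: "(\<Sum>i<N. of_bool (k < i)) = real (N - Suc k)" for k
  proof -
    have "{..<N} \<inter> {i. k < i} = {Suc k..<N}" by auto
    then show ?thesis by (simp add: of_bool_def sum.If_cases)
  qed
  have "(\<Sum>i<N. \<Sum>j<N. C (real i / N) (real j / N)) =
      (\<Sum>i<N. \<Sum>j<N. \<Sum>k<N. \<Sum>l<N. cell_mass C N k l * (of_bool (k < i) * of_bool (l < j)))"
    by (intro sum.cong refl cell_mass_cumulative_indicator[OF assms]) auto
  also have "\<dots> = (\<Sum>k<N. \<Sum>l<N. \<Sum>i<N. \<Sum>j<N.
      cell_mass C N k l * (of_bool (k < i) * of_bool (l < j)))"
    by (rule sum_swap_pairs)
  also have "\<dots> = (\<Sum>k<N. \<Sum>l<N. cell_mass C N k l * (real (N - Suc k) * real (N - Suc l)))"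
    unfolding count[symmetric] sum_product by (simp only: sum_distrib_left)
  finally show ?thesis .
qed

lemma grid_diagonal_sum:
  assumes "copula C"
  shows "(\<Sum>i<N. C (real (Suc i) / N) (real (Suc i) / N))
    = (\<Sum>k<N. \<Sum>l<N. cell_mass C N k l * real (N - max k l))"
proof -
  have count: "(\<Sum>i<N. of_bool (k < Suc i) * of_bool (l < Suc i)) = real (N - max k l)" for k l
  proof -
    have "{..<N} \<inter> {i. k \<le> i \<and> l \<le> i} = {max k l..<N}" by auto
    then show ?thesis by (simp add: of_bool_conj[symmetric] less_Suc_eq_le del: of_bool_conj)
  qed
  have "(\<Sum>i<N. C (real (Suc i) / N) (real (Suc i) / N)) =
      (\<Sum>i<N. \<Sum>k<N. \<Sum>l<N. cell_mass C N k l * (of_bool (k < Suc i) * of_bool (l < Suc i)))"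
    by (intro sum.cong refl cell_mass_cumulative_indicator[OF assms]) auto
  also have "\<dots> = (\<Sum>k<N. \<Sum>l<N. \<Sum>i<N.
      cell_mass C N k l * (of_bool (k < Suc i) * of_bool (l < Suc i)))"
    by (subst sum.swap, intro sum.cong refl sum.swap)
  finally show ?thesis unfolding sum_distrib_left[symmetric] count .
qed

section \<open>The lower bound\<close>

text \<open>The right-hand side is \<open>2 \<integral> potential l\<close>: each cell of the grid contributes the values of
  the potential at its two coordinates, and as every row and every column of cells has mass
  \<open>1 / N\<close>, both contributions are Riemann sums of the potential.\<close>

lemma copula_tangent_bound:
  assumes C: "copula C" and l: "0 \<le> l" "l \<le> 1"
  shows "integral ({0..1} \<times> {0..1}) (\<lambda>(u, v). C u v) - l * integral {0..1} (\<lambda>u. C u u)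
    \<ge> 1 / 6 - l / 4 - l ^ 3 / 12"
proof -
  let ?I = "integral ({0..1} \<times> {0..1}) (\<lambda>(u, v). C u v)"
  let ?D = "integral {0..1} (\<lambda>u. C u u)"
  let ?P = "\<lambda>u. integral {0..1} (\<lambda>v. C u v)"
  let ?K = "1 / 6 - l / 4 - l ^ 3 / 12"
  have int_row: "C u integrable_on {0..1}" if "u \<in> {0..1}" for u
    using that by (intro integrable_continuous_interval copula_continuous_compose[OF C] continuous_intros) auto
  have int_diag: "(\<lambda>u. C u u) integrable_on {0..1}"
    by (intro integrable_continuous_interval copula_continuous_compose[OF C] continuous_intros) auto
  have mono_row: "mono_on {0..1} (C u)" if "u \<in> {0..1}" for u
    using that by (auto intro!: mono_onI copula_mono[OF C])
  have mono_P: "mono_on {0..1} ?P"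
    by (auto intro!: mono_onI integral_le int_row copula_mono[OF C])
  have mono_diag: "mono_on {0..1} (\<lambda>u. C u u)"
    by (auto intro!: mono_onI copula_mono[OF C])
  have int_pot: "potential l integrable_on {0..1}"
    and pot: "integral {0..1} (potential l) = 1 / 12 - l / 8 - l ^ 3 / 24"
    using potential_integral[OF l] by (auto simp: has_integral_iff)
  \<comment> \<open>one \<open>1 / N\<close> is lost in the diagonal sum, and \<open>2 / N\<close> in the two sums of the potential\<close>
  have grid: "?K - 3 / real N \<le> ?I - l * ?D" if N: "N > 0" for N
  proof -
    define m where "m = cell_mass C N"
    \<comment> \<open>the distance of the far side of the \<open>k\<close>-th cell from \<open>1\<close>\<close>
    define t where "t = (\<lambda>k. real (N - Suc k) / real N)"
    have in01: "real k / real N \<in> {0..1}" if "k \<le> N" for k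
      using that N by (auto simp: divide_le_eq_1)
    have "(\<Sum>i<N. \<Sum>j<N. C (real i / N) (real j / N)) / (real N * real N)
        = (\<Sum>i<N. (\<Sum>j<N. C (real i / N) (real j / N)) / N) / N"
      by (simp add: sum_divide_distrib)
    also have "\<dots> \<le> (\<Sum>i<N. ?P (real i / N)) / N"
      by (intro divide_right_mono sum_mono riemann_sums_mono(1)[OF mono_row int_row N] in01) auto
    also have "\<dots> \<le> integral {0..1} ?P"
      by (rule riemann_sums_mono(1)[OF mono_P copula_double_integral(2)[OF C] N])
    finally have I: "(\<Sum>k<N. \<Sum>l<N. m k l * (t k * t l)) \<le> ?I"
      unfolding grid_sum[OF C] copula_double_integral(1)[OF C] m_def t_def
      by (simp add: sum_divide_distrib)
    have "?D \<le> (\<Sum>i<N. C (real (Suc i) / N) (real (Suc i) / N)) / N"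
      by (rule riemann_sums_mono(2)[OF mono_diag int_diag N])
    also have "\<dots> = (\<Sum>k<N. \<Sum>l<N. m k l * (min (t k) (t l) + 1 / N))"
      unfolding grid_diagonal_sum[OF C] m_def sum_divide_distrib
    proof (intro sum.cong refl)
      fix k j assume "k \<in> {..<N}" "j \<in> {..<N}"
      then have "real (N - max k j) / N = min (t k) (t j) + 1 / N"
        unfolding t_def by (auto simp: min_def max_def field_simps of_nat_diff)
      then show "cell_mass C N k j * real (N - max k j) / N
          = cell_mass C N k j * (min (t k) (t j) + 1 / N)"
        by (metis times_divide_eq_right)
    qed
    also have "\<dots> = (\<Sum>k<N. \<Sum>l<N. m k l * min (t k) (t l)) + (\<Sum>k<N. \<Sum>l<N. m k l) / N"
      by (simp add: distrib_left sum.distrib sum_divide_distrib)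
    also have "(\<Sum>k<N. \<Sum>l<N. m k l) = 1"
      unfolding m_def using cell_mass_row_sum[OF C N] N by simp
    finally have D: "?D \<le> (\<Sum>k<N. \<Sum>l<N. m k l * min (t k) (t l)) + 1 / N" .
    have "(\<Sum>k<N. \<Sum>j<N. m k j * (potential l (t k) + potential l (t j)))
        \<le> (\<Sum>k<N. \<Sum>j<N. m k j * (t k * t j - l * min (t k) (t j)))"
      unfolding m_def
      by (intro sum_mono mult_left_mono potential_bound l cell_mass_nonneg[OF C]) auto
    also have "\<dots> = (\<Sum>k<N. \<Sum>j<N. m k j * (t k * t j)) - l * (\<Sum>k<N. \<Sum>j<N. m k j * min (t k) (t j))"
      by (simp add: right_diff_distrib sum_subtractf sum_distrib_left mult_ac)
    also have "\<dots> \<le> ?I - l * (?D - 1 / N)"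
      using I D l by (intro diff_mono mult_left_mono) auto
    also have "\<dots> \<le> ?I - l * ?D + 1 / N"
      using l N by (simp add: right_diff_distrib divide_right_mono)
    finally have 1: "(\<Sum>k<N. \<Sum>j<N. m k j * (potential l (t k) + potential l (t j)))
        \<le> ?I - l * ?D + 1 / N" .
    have "(\<Sum>k<N. \<Sum>j<N. m k j * (potential l (t k) + potential l (t j)))
        = (\<Sum>k<N. \<Sum>j<N. m k j * potential l (t k)) + (\<Sum>j<N. \<Sum>k<N. m k j * potential l (t j))"
      by (subst (3) sum.swap) (simp add: distrib_left sum.distrib)
    also have "(\<Sum>k<N. \<Sum>j<N. m k j * potential l (t k)) = (\<Sum>k<N. potential l (t k)) / N"
      unfolding m_def sum_distrib_right[symmetric] using cell_mass_row_sum[OF C N]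
      by (simp add: sum_divide_distrib)
    also have "(\<Sum>j<N. \<Sum>k<N. m k j * potential l (t j)) = (\<Sum>k<N. potential l (t k)) / N"
      unfolding m_def sum_distrib_right[symmetric] using cell_mass_col_sum[OF C N]
      by (simp add: sum_divide_distrib)
    also have "(\<Sum>k<N. potential l (t k)) = (\<Sum>k<N. potential l (real k / N))"
      unfolding t_def by (rule sum.nat_diff_reindex)
    finally have 2: "(\<Sum>k<N. \<Sum>j<N. m k j * (potential l (t k) + potential l (t j)))
        = 2 * ((\<Sum>k<N. potential l (real k / N)) / N)" by simp
    have "(\<Sum>k<N. 2 * (real k / N) - potential l (real k / N)) / N
        \<le> integral {0..1} (\<lambda>x. 2 * x - potential l x)"
      by (intro riemann_sums_mono(1) potential_one_sided_lipschitz l N integrable_diff int_pot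
          integrable_continuous_interval continuous_intros)
    also have "\<dots> = integral {0..1} (\<lambda>x. 2 * x) - integral {0..1} (potential l)"
      by (intro Henstock_Kurzweil_Integration.integral_diff int_pot
          integrable_continuous_interval continuous_intros)
    also have "integral {0..1} (\<lambda>x::real. 2 * x) = 1"
      by (simp add: integral_unique[OF ident_has_integral])
    also have "(\<Sum>k<N. 2 * (real k / N) - potential l (real k / N)) / N
        = (\<Sum>k<N. real k) * 2 / (N * N) - (\<Sum>k<N. potential l (real k / N)) / N"
      by (simp add: sum_subtractf diff_divide_distrib sum_divide_distrib sum_distrib_left sum_distrib_right mult_ac)
    also have "(\<Sum>k<N. real k) * 2 / (N * N) = 1 - 1 / N"
    proof -
      have "(\<Sum>k<n. real k) * 2 = real n * (real n - 1)" for n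
        by (induction n) (auto simp: algebra_simps)
      then show ?thesis using N by (simp add: field_simps)
    qed
    finally have 3: "integral {0..1} (potential l) - 1 / N \<le> (\<Sum>k<N. potential l (real k / N)) / N"
      by simp
    show ?thesis
      using 1 3 unfolding 2 pot by simp
  qed
  have "(\<lambda>N. ?K - 3 / real N) \<longlonglongrightarrow> ?K - 0"
    by (intro tendsto_intros lim_const_over_n)
  then have "?K \<le> ?I - l * ?D"
    using grid by (intro LIMSEQ_le_const2[of _ ?K]) (auto intro!: exI[of _ 1])
  then show ?thesis .
qed

text \<open>These bounds make the slope \<open>l = sqrt (4 D - 1)\<close> a number in \<open>[0, 1]\<close>; in particular the base
  \<open>1 + 2 \<phi>\<close> of the real power is nonnegative.\<close>

lemma copula_diagonal_integral_bounds:
  assumes C: "copula C"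
  shows "integral {0..1} (\<lambda>u. C u u) \<in> {1 / 4..1 / 2}"
proof -
  have int_diag: "(\<lambda>u. C u u) integrable_on {0..1}"
    by (intro integrable_continuous_interval copula_continuous_compose[OF C] continuous_intros) auto
  have "integral {0..1} (\<lambda>u. C u u) \<le> integral {0..1} (\<lambda>u. u)"
    using copula_mono[OF C, of u u u 1 for u] copula_grounded[OF C]
    by (intro integral_le int_diag integrable_continuous_interval continuous_intros) force
  then have "integral {0..1} (\<lambda>u. C u u) \<le> 1 / 2" by (simp add: integral_unique[OF ident_has_integral])
  moreover have "integral {1 / 2..1} (\<lambda>u. 2 * u - 1) \<le> integral {1 / 2..1} (\<lambda>u. C u u)"
  proof (intro integral_le integrable_subinterval_real[OF int_diag]
      integrable_continuous_interval continuous_intros)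
    fix u :: real assume "u \<in> {1 / 2..1}"
    then show "2 * u - 1 \<le> C u u"
      using copula_rect_nonneg[OF C, of u 1 u 1] copula_grounded[OF C, of u] copula_grounded[OF C, of 1]
      by auto
  qed auto
  moreover have "integral {1 / 2..1} (\<lambda>u. C u u) \<le> integral {0..1} (\<lambda>u. C u u)"
    using C unfolding copula_def
    by (intro integral_subset_le integrable_subinterval_real[OF int_diag] int_diag) auto
  moreover have "((\<lambda>u::real. 2 * u - 1) has_integral (1\<^sup>2 - 1) - ((1 / 2)\<^sup>2 - 1 / 2)) {1 / 2..1}"
    by (intro fundamental_theorem_of_calculus)
      (auto intro!: derivative_eq_intros simp: has_real_derivative_iff_has_vector_derivative[symmetric])
  then have "integral {1 / 2..1} (\<lambda>u::real. 2 * u - 1) = 1 / 4"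
    by (subst integral_unique) (auto simp: power2_eq_square)
  ultimately show ?thesis by simp
qed

lemma footrule_bound_parametrised:
  assumes "l \<ge> 0" "l\<^sup>2 = (1 + 2 * p) / 3"
  shows "2 / 9 * sqrt 3 * (1 + 2 * p) powr (3 / 2) - 1 = 2 * l ^ 3 - 1"
proof (cases "l = 0")
  case False
  have "(1 + 2 * p) powr (3 / 2) = (sqrt 3 * l) powr 3"
  proof -
    have "1 + 2 * p = (sqrt 3 * l) powr 2"
      using assms False by (simp add: power_mult_distrib)
    then show ?thesis by (simp add: powr_powr)
  qed
  also have "\<dots> = (sqrt 3 * l) ^ 3"
    using assms(1) False by simp
  also have "\<dots> = sqrt 3 * 3 * l ^ 3"
    by (simp add: power_mult_distrib power3_eq_cube)
  finally show ?thesis by simp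
qed (use assms in simp)

theorem spearman_rho_lower_bound:
  assumes C: "copula C"
  shows "2 / 9 * sqrt 3 * (1 + 2 * spearman_footrule C) powr (3 / 2) - 1 \<le> spearman_rho C"
proof -
  let ?I = "integral ({0..1} \<times> {0..1}) (\<lambda>(u, v). C u v)"
  define d where "d = integral {0..1} (\<lambda>u. C u u)"
  \<comment> \<open>the slope for which the tangent bound is sharpest at this value of the footrule\<close>
  define l where "l = sqrt (4 * d - 1)"
  have d: "1 / 4 \<le> d" "d \<le> 1 / 2"
    using copula_diagonal_integral_bounds[OF C] by (auto simp: d_def)
  then have l: "0 \<le> l" "l \<le> 1" "l\<^sup>2 = 4 * d - 1" by (auto simp: l_def)
  have "1 / 6 - l / 4 - l ^ 3 / 12 \<le> ?I - l * d"
    using copula_tangent_bound[OF C l(1,2)] by (simp add: d_def)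
  moreover have "l * d = l * (1 + l\<^sup>2) / 4" using l(3) by simp
  ultimately have "2 * l ^ 3 - 1 \<le> spearman_rho C"
    unfolding spearman_rho_def by (simp add: power2_eq_square power3_eq_cube field_simps)
  moreover have "l\<^sup>2 = (1 + 2 * spearman_footrule C) / 3"
    using l(3) by (simp add: spearman_footrule_def d_def)
  ultimately show ?thesis
    using footrule_bound_parametrised[OF l(1)] by simp
qed

section \<open>The extremal shuffles\<close>

lemma measure_diagonal_mass_increasing:
  assumes "0 \<le> a" "0 \<le> c"
  shows "measure (diagonal_mass a b c 1) ({0..x} \<times> {0..y}) = max 0 (min b (min x (y - c + a)) - a)"
proof -
  have m: "(\<lambda>t. (t, if (1::int) = 1 then c + (t - a) else c + (b - t)))
      \<in> restrict_space lborel {a..b} \<rightarrow>\<^sub>M borel"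
    by (intro measurable_restrict_space1 borel_measurable_continuous_onI) (auto intro!: continuous_intros)
  have "(\<lambda>t. (t, if (1::int) = 1 then c + (t - a) else c + (b - t))) -` ({0..x} \<times> {0..y})
      \<inter> space (restrict_space lborel {a..b}) = {a..min b (min x (y - c + a))}"
    using assms by (auto simp: space_restrict_space)
  then have "measure (diagonal_mass a b c 1) ({0..x} \<times> {0..y})
      = measure (restrict_space lborel {a..b}) {a..min b (min x (y - c + a))}"
    unfolding diagonal_mass_def by (subst measure_distr[OF m]) (auto intro!: borel_closed closed_Times)
  also have "\<dots> = measure lborel {a..min b (min x (y - c + a))}"
    by (intro measure_restrict_space) auto
  finally show ?thesis by (auto simp: measure_def max_def)
qed

lemma measure_diagonal_mass_decreasing:
  assumes "0 \<le> a" "0 \<le> c"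
  shows "measure (diagonal_mass a b c (-1)) ({0..x} \<times> {0..y}) = max 0 (min b x - max a (c + b - y))"
proof -
  have m: "(\<lambda>t. (t, if (-1::int) = 1 then c + (t - a) else c + (b - t)))
      \<in> restrict_space lborel {a..b} \<rightarrow>\<^sub>M borel"
    by (intro measurable_restrict_space1 borel_measurable_continuous_onI) (auto intro!: continuous_intros)
  have "(\<lambda>t. (t, if (-1::int) = 1 then c + (t - a) else c + (b - t))) -` ({0..x} \<times> {0..y})
      \<inter> space (restrict_space lborel {a..b}) = {max a (c + b - y)..min b x}"
    using assms by (auto simp: space_restrict_space)
  then have "measure (diagonal_mass a b c (-1)) ({0..x} \<times> {0..y})
      = measure (restrict_space lborel {a..b}) {max a (c + b - y)..min b x}"
    unfolding diagonal_mass_def by (subst measure_distr[OF m]) (auto intro!: borel_closed closed_Times)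
  also have "\<dots> = measure lborel {max a (c + b - y)..min b x}"
    by (intro measure_restrict_space) auto
  finally show ?thesis by (auto simp: measure_def max_def)
qed

text \<open>The shuffle that exchanges \<open>[0, a]\<close> and \<open>[1 - a, 1]\<close> by the reflection \<open>t \<mapsto> 1 - t\<close> and
  fixes \<open>[a, 1 - a]\<close>; the summands are the masses of \<open>[0, x] \<times> [0, y]\<close> on the three diagonals,
  each the length of an interval of the first coordinate.\<close>

definition extremal :: "real \<Rightarrow> real \<Rightarrow> real \<Rightarrow> real" where
  "extremal a x y = max 0 (min a x - (1 - y)) + max 0 (min (1 - a) (min x y) - a)
     + max 0 (x - max (1 - a) (1 - y))"

text \<open>Each summand gives nonnegative mass to rectangles. The first and the third are a convex function,
  the positive part, of a sum of an increasing function of \<open>x\<close> and one of \<open>y\<close>; the second is the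
  minimum of an increasing function of \<open>x\<close> and one of \<open>y\<close>.\<close>

lemma extremal_copula:
  assumes a: "0 \<le> a" "a \<le> 1 / 2"
  shows "copula (extremal a)"
proof -
  define F1 F2 F3 where "F1 = (\<lambda>x y::real. max 0 (min a x - (1 - y)))"
    and "F2 = (\<lambda>x y. max 0 (min (1 - a) (min x y) - a))"
    and "F3 = (\<lambda>x y. max 0 (x - max (1 - a) (1 - y)))"
  have rect_ge: "f (a2 + b2) - f (a2 + b1) - f (a1 + b2) + f (a1 + b1) \<ge> 0"
    if "f = max (0::real)" "a1 \<le> a2" "b1 \<le> b2" for f a1 a2 b1 b2
    using that unfolding max_def by auto
  have min_rect: "min a2 b2 - min a2 b1 - min a1 b2 + min a1 b1 \<ge> 0"
    if "a1 \<le> a2" "b1 \<le> b2" for a1 a2 b1 b2 :: real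
    using that unfolding min_def by auto
  have 1: "F1 x2 y2 - F1 x2 y1 - F1 x1 y2 + F1 x1 y1 \<ge> 0" if "x1 \<le> x2" "y1 \<le> y2" for x1 x2 y1 y2
    using rect_ge[OF refl, of "min a x1" "min a x2" "y1 - 1" "y2 - 1"] that
    unfolding F1_def by (simp add: diff_diff_eq2 add_diff_eq)
  have F2: "F2 x y = min (max 0 (min (1 - a) x - a)) (max 0 (min (1 - a) y - a))" for x y
    unfolding F2_def by auto
  have 2: "F2 x2 y2 - F2 x2 y1 - F2 x1 y2 + F2 x1 y1 \<ge> 0" if "x1 \<le> x2" "y1 \<le> y2" for x1 x2 y1 y2
    unfolding F2 using that by (intro min_rect) auto
  have 3: "F3 x2 y2 - F3 x2 y1 - F3 x1 y2 + F3 x1 y1 \<ge> 0" if "x1 \<le> x2" "y1 \<le> y2" for x1 x2 y1 y2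
    using rect_ge[OF refl, of x1 x2 "- max (1 - a) (1 - y1)" "- max (1 - a) (1 - y2)"] that
    unfolding F3_def by simp
  have E: "extremal a x y = F1 x y + F2 x y + F3 x y" for x y
    by (simp add: extremal_def F1_def F2_def F3_def)
  have rect: "extremal a u2 v2 - extremal a u2 v1 - extremal a u1 v2 + extremal a u1 v1 \<ge> 0"
    if "u1 \<le> u2" "v1 \<le> v2" for u1 u2 v1 v2
    using 1[OF that] 2[OF that] 3[OF that] unfolding E by linarith
  have margins: "extremal a u 0 = 0" "extremal a 0 u = 0" "extremal a u 1 = u" "extremal a 1 u = u"
    if "u \<in> {0..1}" for u
    using a that unfolding extremal_def by (auto simp: min_def max_def)
  have "extremal a u v \<in> {0..1}" if uv: "u \<in> {0..1}" "v \<in> {0..1}" for u v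
  proof -
    have "0 \<le> extremal a u v" unfolding extremal_def by simp
    moreover have "extremal a u v \<le> extremal a u 1"
      using rect[of 0 u v 1] margins[OF uv(2)] margins[of 1] uv by simp
    ultimately show ?thesis using margins[OF uv(1)] uv by simp
  qed
  then show ?thesis
    unfolding copula_def using margins rect by blast
qed

text \<open>The permutation exchanges intervals of equal length, so the splitting points of the second
  coordinate are those of the first.\<close>

lemma extremal_is_shuffle:
  assumes a: "0 \<le> a" "a \<le> 1 / 2"
  shows "shuffle_of_M (extremal a)"
proof -
  define u where "u = (\<lambda>i::nat. if i = 0 then 0 else if i = 1 then a else if i = 2 then 1 - a else 1)"
  define w :: "nat \<Rightarrow> int" where "w = (\<lambda>i. if i = 2 then 1 else -1)"
  define p :: "nat \<Rightarrow> nat" where "p = Transposition.transpose 1 3"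
  have all3: "(\<forall>i\<in>{1..3}. P i) \<longleftrightarrow> P 1 \<and> P 2 \<and> P 3" for P :: "nat \<Rightarrow> bool"
    by (auto simp: numeral_3_eq_3 numeral_2_eq_2 le_Suc_eq)
  have sum3: "(\<Sum>i=1..3. f i) = f 1 + f 2 + f 3" for f :: "nat \<Rightarrow> real"
    by (simp add: numeral_3_eq_3 numeral_2_eq_2)
  have p: "p 1 = 3" "p 2 = 2" "p 3 = 1" by (auto simp: p_def Transposition.transpose_def)
  have vals: "u 0 = 0" "u 1 = a" "u 2 = 1 - a" "u 3 = 1" "w 1 = -1" "w 2 = 1" "w 3 = -1"
    and preds: "1 - 1 = (0::nat)" "2 - 1 = (1::nat)" "3 - 1 = (2::nat)"
    by (simp_all add: u_def w_def)
  have perm: "p permutes {1..3}"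
    unfolding p_def by (rule permutes_swap_id) auto
  have mass: "extremal a x y =
      (\<Sum>i=1..3. measure (diagonal_mass (u (i - 1)) (u i) (u (p i - 1)) (w i)) ({0..x} \<times> {0..y}))"
    if xy: "x \<in> {0..1}" "y \<in> {0..1}" for x y
  proof -
    have "measure (diagonal_mass 0 a (1 - a) (-1)) ({0..x} \<times> {0..y}) = max 0 (min a x - (1 - y))"
      using a xy by (subst measure_diagonal_mass_decreasing) auto
    moreover have "measure (diagonal_mass a (1 - a) a 1) ({0..x} \<times> {0..y})
        = max 0 (min (1 - a) (min x y) - a)"
      using a by (subst measure_diagonal_mass_increasing) auto
    moreover have "measure (diagonal_mass (1 - a) 1 0 (-1)) ({0..x} \<times> {0..y})
        = max 0 (x - max (1 - a) (1 - y))"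
      using a xy by (subst measure_diagonal_mass_decreasing) (auto simp: min_absorb2)
    ultimately show ?thesis
      unfolding sum3 p preds vals extremal_def by simp
  qed
  have "is_shuffle (extremal a) 3 u p w"
    unfolding is_shuffle_def
  proof (intro conjI exI[of _ u])
    show "\<forall>i\<in>{1..3}. u (i - 1) \<le> u i" "\<forall>i\<in>{1..3}. u (i - 1) \<le> u i"
      unfolding all3 preds vals using a by auto
    show "\<forall>i\<in>{1..3}. w i \<in> {-1, 1}"
      unfolding all3 vals by simp
    show "\<forall>i\<in>{1..3}. u (p i) - u (p i - 1) = u i - u (i - 1)"
      unfolding all3 p preds vals by simp
    show "\<forall>x\<in>{0..1}. \<forall>y\<in>{0..1}. extremal a x y =
        (\<Sum>i=1..3. measure (diagonal_mass (u (i - 1)) (u i) (u (p i - 1)) (w i)) ({0..x} \<times> {0..y}))"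
      using mass by blast
  qed (rule zero_less_numeral vals perm)+
  then show ?thesis unfolding shuffle_of_M_def by blast
qed

lemma has_integral_pos_part:
  assumes "0 \<le> c" "c \<le> 1"
  shows "((\<lambda>t. max 0 (t - c)) has_integral (1 - c)\<^sup>2 / 2) {0..1::real}"
proof -
  have "((\<lambda>t. t - c) has_integral (1 - c)\<^sup>2 / 2 - (c - c)\<^sup>2 / 2) {c..1}"
    using assms by (intro fundamental_theorem_of_calculus)
      (auto intro!: derivative_eq_intros simp: has_real_derivative_iff_has_vector_derivative[symmetric])
  then have 1: "((\<lambda>t. max 0 (t - c)) has_integral (1 - c)\<^sup>2 / 2 - (c - c)\<^sup>2 / 2) {c..1}"
    by (rule has_integral_eq[rotated]) auto
  have 2: "((\<lambda>t. max 0 (t - c)) has_integral 0) {0..c}"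
    by (rule has_integral_is_0) auto
  show ?thesis
    using has_integral_combine[OF assms 2 1] by simp
qed

text \<open>On the unit interval the diagonal section is \<open>max 0 (u - a) + max 0 (u - (1 - a))\<close>.\<close>

lemma extremal_diagonal_integral:
  assumes a: "0 \<le> a" "a \<le> 1 / 2"
  shows "integral {0..1} (\<lambda>u. extremal a u u) = (a\<^sup>2 + (1 - a)\<^sup>2) / 2"
proof -
  have "((\<lambda>u. max 0 (u - a) + max 0 (u - (1 - a))) has_integral
      (1 - a)\<^sup>2 / 2 + (1 - (1 - a))\<^sup>2 / 2) {0..1}"
    using a by (intro has_integral_add has_integral_pos_part) auto
  then have "((\<lambda>u. extremal a u u) has_integral (1 - a)\<^sup>2 / 2 + (1 - (1 - a))\<^sup>2 / 2) {0..1}"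
    by (rule has_integral_eq[rotated])
      (use a in \<open>auto simp: extremal_def min_def max_def\<close>)
  then show ?thesis by (subst integral_unique) (auto simp: field_simps)
qed

text \<open>For fixed \<open>x\<close> the function of \<open>y\<close> is piecewise linear, hence a combination of positive parts;
  \<open>w\<close> and \<open>z\<close> are the masses that the second and the third diagonal have over \<open>[0, x]\<close>.\<close>

lemma extremal_row_integral:
  assumes a: "0 \<le> a" "a \<le> 1 / 2" and x: "0 \<le> x" "x \<le> 1"
  shows "integral {0..1} (extremal a x) =
    (if a \<le> x \<and> x \<le> 1 - a then (a\<^sup>2 + (1 - a)\<^sup>2 - (1 - x)\<^sup>2) / 2 else x\<^sup>2 / 2)"
proof -
  define w z where "w = max 0 (min (1 - a) x - a)" and "z = max 0 (x - (1 - a))"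
  have wz: "0 \<le> w" "w \<le> 1 - 2 * a" "0 \<le> z" "z \<le> a"
    using a x by (auto simp: w_def z_def)
  have "((\<lambda>y. max 0 (y - (1 - min a x)) + (max 0 (y - a) - max 0 (y - (a + w)))
      + (max 0 (y - (a - z)) - max 0 (y - a))) has_integral
      (1 - (1 - min a x))\<^sup>2 / 2 + ((1 - a)\<^sup>2 / 2 - (1 - (a + w))\<^sup>2 / 2)
      + ((1 - (a - z))\<^sup>2 / 2 - (1 - a)\<^sup>2 / 2)) {0..1}"
    using a x wz by (intro has_integral_add has_integral_diff has_integral_pos_part) auto
  then have "(extremal a x has_integral
      (1 - (1 - min a x))\<^sup>2 / 2 + ((1 - a)\<^sup>2 / 2 - (1 - (a + w))\<^sup>2 / 2)
      + ((1 - (a - z))\<^sup>2 / 2 - (1 - a)\<^sup>2 / 2)) {0..1}"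
  proof (rule has_integral_eq[rotated])
    fix y :: real assume y: "y \<in> {0..1}"
    have "max 0 (min (1 - a) (min x y) - a) = max 0 (y - a) - max 0 (y - (a + w))"
      using a by (auto simp: w_def min_def max_def)
    moreover have "max 0 (x - max (1 - a) (1 - y)) = max 0 (y - (a - z)) - max 0 (y - a)"
      using a by (auto simp: z_def min_def max_def)
    ultimately show "max 0 (y - (1 - min a x)) + (max 0 (y - a) - max 0 (y - (a + w)))
        + (max 0 (y - (a - z)) - max 0 (y - a)) = extremal a x y"
      unfolding extremal_def by (simp add: algebra_simps)
  qed
  then have int: "integral {0..1} (extremal a x) = (min a x)\<^sup>2 / 2
      + ((1 - a)\<^sup>2 / 2 - (1 - (a + w))\<^sup>2 / 2) + ((1 - (a - z))\<^sup>2 / 2 - (1 - a)\<^sup>2 / 2)"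
    by (subst integral_unique) auto
  consider "x < a" | "a \<le> x" "x \<le> 1 - a" | "1 - a < x" by linarith
  then show ?thesis
  proof cases
    case 1
    then have "w = 0" "z = 0" using a by (auto simp: w_def z_def)
    then show ?thesis using 1 int by simp
  next
    case 2
    then have "w = x - a" "z = 0" by (auto simp: w_def z_def)
    then show ?thesis using 2 int by (simp add: field_simps)
  next
    case 3
    then have e: "w = 1 - 2 * a" "z = x - (1 - a)" "min a x = a" using a by (auto simp: w_def z_def)
    show ?thesis using 3 unfolding int e by (simp add: power2_eq_square field_simps)
  qed
qed

lemma extremal_double_integral:
  assumes a: "0 \<le> a" "a \<le> 1 / 2"
  shows "integral ({0..1} \<times> {0..1}) (\<lambda>(u, v). extremal a u v) = (1 + (1 - 2 * a) ^ 3) / 6"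
proof -
  let ?P = "\<lambda>u. integral {0..1} (extremal a u)"
  have "((\<lambda>u. u\<^sup>2 / 2) has_integral a ^ 3 / 6 - 0 ^ 3 / 6) {0..a}"
    using a by (intro fundamental_theorem_of_calculus)
      (auto intro!: derivative_eq_intros simp: has_real_derivative_iff_has_vector_derivative[symmetric])
  then have 1: "(?P has_integral a ^ 3 / 6 - 0 ^ 3 / 6) {0..a}"
    by (rule has_integral_spike_finite[of "{a}", rotated 2])
      (use a in \<open>auto simp: extremal_row_integral\<close>)
  have "((\<lambda>u. (a\<^sup>2 + (1 - a)\<^sup>2 - (1 - u)\<^sup>2) / 2) has_integral
      ((a\<^sup>2 + (1 - a)\<^sup>2) * (1 - a) / 2 + (1 - (1 - a)) ^ 3 / 6)
        - ((a\<^sup>2 + (1 - a)\<^sup>2) * a / 2 + (1 - a) ^ 3 / 6)) {a..1 - a}"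
    using a by (intro fundamental_theorem_of_calculus)
      (auto intro!: derivative_eq_intros simp: has_real_derivative_iff_has_vector_derivative[symmetric]
        field_simps)
  then have 2: "(?P has_integral
      ((a\<^sup>2 + (1 - a)\<^sup>2) * (1 - a) / 2 + (1 - (1 - a)) ^ 3 / 6)
        - ((a\<^sup>2 + (1 - a)\<^sup>2) * a / 2 + (1 - a) ^ 3 / 6)) {a..1 - a}"
    by (rule has_integral_eq[rotated])
      (use a in \<open>auto simp: extremal_row_integral\<close>)
  have "((\<lambda>u. u\<^sup>2 / 2) has_integral 1 ^ 3 / 6 - (1 - a) ^ 3 / 6) {1 - a..1}"
    using a by (intro fundamental_theorem_of_calculus)
      (auto intro!: derivative_eq_intros simp: has_real_derivative_iff_has_vector_derivative[symmetric])
  then have 3: "(?P has_integral 1 ^ 3 / 6 - (1 - a) ^ 3 / 6) {1 - a..1}"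
    by (rule has_integral_spike_finite[of "{1 - a}", rotated 2])
      (use a in \<open>auto simp: extremal_row_integral\<close>)
  have "integral {0..1} ?P = a ^ 3 / 6 - 0 ^ 3 / 6
      + (((a\<^sup>2 + (1 - a)\<^sup>2) * (1 - a) / 2 + (1 - (1 - a)) ^ 3 / 6)
        - ((a\<^sup>2 + (1 - a)\<^sup>2) * a / 2 + (1 - a) ^ 3 / 6))
      + (1 ^ 3 / 6 - (1 - a) ^ 3 / 6)"
    using has_integral_combine[OF _ _ has_integral_combine[OF _ _ 1 2] 3] a
    by (intro integral_unique) simp
  also have "\<dots> = (1 + (1 - 2 * a) ^ 3) / 6"
    by (simp add: power2_eq_square power3_eq_cube field_simps)
  finally show ?thesis
    unfolding copula_double_integral(1)[OF extremal_copula[OF a]] .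
qed

lemma extremal_attains_bound:
  assumes p: "- (1 / 2) \<le> p" "p \<le> 1"
  obtains C where "copula C" "shuffle_of_M C" "spearman_footrule C = p"
    "spearman_rho C = 2 / 9 * sqrt 3 * (1 + 2 * p) powr (3 / 2) - 1"
proof -
  define l where "l = sqrt ((1 + 2 * p) / 3)"
  have l: "0 \<le> l" "l \<le> 1" "l\<^sup>2 = (1 + 2 * p) / 3"
    using p by (auto simp: l_def)
  define a where "a = (1 - l) / 2"
  have a: "0 \<le> a" "a \<le> 1 / 2" using l by (auto simp: a_def)
  have l_eq: "1 - 2 * a = l" by (simp add: a_def field_simps)
  have "a\<^sup>2 + (1 - a)\<^sup>2 = (1 + l\<^sup>2) / 2"
    by (simp add: a_def power2_eq_square field_simps)
  then have "spearman_footrule (extremal a) = p"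
    unfolding spearman_footrule_def extremal_diagonal_integral[OF a] l(3) by (simp add: field_simps)
  moreover have "spearman_rho (extremal a) = 2 * l ^ 3 - 1"
    unfolding spearman_rho_def extremal_double_integral[OF a] l_eq by simp
  ultimately show ?thesis
    using that[OF extremal_copula[OF a] extremal_is_shuffle[OF a]]
      footrule_bound_parametrised[OF l(1,3)] by simp
qed

theorem theorem8:
  shows "(\<forall>C. copula C \<longrightarrow>
            2 / 9 * sqrt 3 * (1 + 2 * spearman_footrule C) powr (3 / 2) - 1 \<le> spearman_rho C) \<and>
         (\<forall>p\<in>{- (1 / 2)..1::real}. \<exists>C. copula C \<and> shuffle_of_M C \<and> spearman_footrule C = p \<and>
            spearman_rho C = 2 / 9 * sqrt 3 * (1 + 2 * p) powr (3 / 2) - 1)"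
proof (intro conjI allI impI ballI)
  fix C assume "copula C"
  then show "2 / 9 * sqrt 3 * (1 + 2 * spearman_footrule C) powr (3 / 2) - 1 \<le> spearman_rho C"
    by (rule spearman_rho_lower_bound)
next
  fix p :: real assume "p \<in> {- (1 / 2)..1}"
  then have "- (1 / 2) \<le> p" "p \<le> 1" by auto
  then show "\<exists>C. copula C \<and> shuffle_of_M C \<and> spearman_footrule C = p \<and>
      spearman_rho C = 2 / 9 * sqrt 3 * (1 + 2 * p) powr (3 / 2) - 1"
    by (rule extremal_attains_bound) (intro exI conjI)
qed

end
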